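(* There exist absolute constants $\varepsilon_0>0$ and $c>0$ such that the following holds. Let $0<\varepsilon<\varepsilon_0$ and $\lambda\ge0$. If $\mathbb{E}_{M\sim\mu_{E;\lambda,G}}[|M|]\ge(1-\varepsilon)\nu(G)$ for every graph $G=(V,E)$, then $\lambda\ge 2^{c/\varepsilon}$ (i.e., $\lambda=2^{\Omega(1/\varepsilon)}$).
   Context: For a graph $G=(V,E)$ and $\lambda\ge 0$, $\mu_{E;\lambda,G}$ is the Gibbs distribution on matchings of $G$: $\mu_{E;\lambda,G}(M)=\lambda^{|M|}/Z$ for each matching $M\subseteq E$, with $Z=\sum_{M'}\lambda^{|M'|}$ over all matchings $M'$ of $G$ (with $0^0=1$). $\nu(G)$ denotes the maximum matching size of $G$. *)

theory Defs
  imports "HOL-Probability.Probability"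
begin

definition finite_simple_graph :: "'a set \<Rightarrow> 'a set set \<Rightarrow> bool" where
  "finite_simple_graph V E \<longleftrightarrow> finite V \<and> (\<forall>e\<in>E. e \<subseteq> V \<and> card e = 2)"

definition matchings :: "'a set set \<Rightarrow> 'a set set set" where
  "matchings E = {M. M \<subseteq> E \<and> pairwise disjnt M}"

definition max_matching_size :: "'a set set \<Rightarrow> nat" where
  "max_matching_size E = Max (card ` matchings E)"

definition matching_partition_function :: "real \<Rightarrow> 'a set set \<Rightarrow> real" where
  "matching_partition_function lam E = (\<Sum>M\<in>matchings E. lam ^ card M)"

text \<open>The weights below form a probability mass function if the edge set is finite and
  \<open>lam \<ge> 0\<close>, see lemma \<open>pmf_matching_gibbs\<close>; only then is \<open>embed_pmf\<close> meaningful.\<close>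

definition matching_gibbs :: "real \<Rightarrow> 'a set set \<Rightarrow> 'a set set pmf" where
  "matching_gibbs lam E = embed_pmf (\<lambda>M.
     if M \<in> matchings E then lam ^ card M / matching_partition_function lam E else 0)"

lemma finite_simple_graph_finite_edges:
  assumes "finite_simple_graph V E"
  shows "finite E"
  using assms finite_subset[of E "Pow V"] unfolding finite_simple_graph_def by auto

lemma finite_matchings: "finite E \<Longrightarrow> finite (matchings E)"
  unfolding matchings_def by (rule finite_subset[of _ "Pow E"]) auto

lemma empty_in_matchings: "{} \<in> matchings E"
  by (simp add: matchings_def)

lemma matching_partition_function_pos:
  assumes "finite E" "lam \<ge> 0"
  shows "matching_partition_function lam E > 0"
  unfolding matching_partition_function_def
  by (rule sum_pos2[OF finite_matchings[OF assms(1)] empty_in_matchings])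
     (use assms in auto)

lemma pmf_matching_gibbs:
  assumes "finite E" "lam \<ge> 0"
  shows "pmf (matching_gibbs lam E) M =
    (if M \<in> matchings E then lam ^ card M / matching_partition_function lam E else 0)"
proof -
  let ?Z = "matching_partition_function lam E"
  let ?f = "\<lambda>M. if M \<in> matchings E then lam ^ card M / ?Z else 0"
  note fin = finite_matchings[OF assms(1)] and Z = matching_partition_function_pos[OF assms]
  have nn: "?f M \<ge> 0" for M
    using assms Z by simp
  have "(\<integral>\<^sup>+ M. ennreal (?f M) \<partial>count_space UNIV) = (\<Sum>M\<in>matchings E. ennreal (?f M))"
    by (rule nn_integral_count_space'[OF fin]) auto
  also have "\<dots> = ennreal (\<Sum>M\<in>matchings E. ?f M)"
    by (rule sum_ennreal) (rule nn)
  also have "(\<Sum>M\<in>matchings E. ?f M) = (\<Sum>M\<in>matchings E. lam ^ card M) / ?Z"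
    by (simp add: sum_divide_distrib)
  also have "\<dots> = 1"
    using Z by (simp add: matching_partition_function_def)
  finally have "(\<integral>\<^sup>+ M. ennreal (?f M) \<partial>count_space UNIV) = 1" by simp
  then show ?thesis
    unfolding matching_gibbs_def using nn by (subst pmf_embed_pmf) auto
qed

end

theory Submission imports Defs begin

text \<open>
  The half graph on \<open>2n\<close> vertices has a unique perfect matching, but for \<open>n = 2k + 1\<close> it has at
  least \<open>2 ^ k\<close> matchings of size \<open>n - 1\<close>. Hence for \<open>lam < 2 ^ k\<close> a random matching is
  imperfect with probability above \<open>1/2\<close>, so its expected size is below \<open>n - 1/2\<close>. Taking
  \<open>k\<close> to be about \<open>1 / (4\<epsilon>)\<close> makes this smaller than \<open>(1 - \<epsilon>) n\<close>.
\<close>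

section \<open>Matchings and vertex covers\<close>

text \<open>Pick a vertex of \<open>C\<close> in each edge. Disjoint edges get different vertices,
  so the choice is injective into \<open>C\<close>; when the cardinalities agree it is also
  onto.\<close>

lemma matching_card_le_cover:
  assumes "pairwise disjnt M" "finite C" "\<And>e. e \<in> M \<Longrightarrow> e \<inter> C \<noteq> {}"
  shows "card M \<le> card C"
    and "card M = card C \<Longrightarrow> x \<in> C \<Longrightarrow> \<exists>e\<in>M. x \<in> e"
proof -
  obtain v where v: "\<And>e. e \<in> M \<Longrightarrow> v e \<in> e \<inter> C"
    using assms(3) bchoice[of M "\<lambda>e x. x \<in> e \<inter> C"] by blast
  have inj: "inj_on v M"
  proof (rule inj_onI)
    fix e e' assume "e \<in> M" "e' \<in> M" "v e = v e'"
    then show "e = e'"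
      using v[of e] v[of e'] assms(1) unfolding pairwise_def disjnt_def by fastforce
  qed
  have sub: "v ` M \<subseteq> C"
    using v by auto
  show "card M \<le> card C"
    by (rule card_inj_on_le[OF inj sub assms(2)])
  show "\<exists>e\<in>M. x \<in> e" if "card M = card C" "x \<in> C"
  proof -
    have "v ` M = C"
      by (rule card_subset_eq[OF assms(2) sub]) (simp add: card_image[OF inj] that(1))
    then show ?thesis
      using that(2) v by blast
  qed
qed

section \<open>The half graph and its unique perfect matching\<close>

text \<open>Parity separates the two sides of the bipartition. The neighbourhoods of the even
  vertices are nested, each gaining one odd vertex over the previous one; this rigidity forces the
  perfect matching.\<close>

definition half_graph :: "nat \<Rightarrow> nat set set" where
  "half_graph n = {{2 * j, 2 * i + 1} | i j. i \<le> j \<and> j < n}"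

definition half_graph_perfect :: "nat \<Rightarrow> nat set set" where
  "half_graph_perfect n = (\<lambda>j. {2 * j, 2 * j + 1}) ` {..<n}"

lemma half_graph_simple: "finite_simple_graph {..<2 * n} (half_graph n)"
proof -
  have "card {2 * j, 2 * i + 1} = 2" for i j :: nat
    by (subst card_2_iff) (metis double_not_eq_Suc_double Suc_eq_plus1)
  then show ?thesis
    unfolding finite_simple_graph_def half_graph_def by auto
qed

lemma finite_half_graph: "finite (half_graph n)"
  by (rule finite_simple_graph_finite_edges[OF half_graph_simple])

lemma half_graph_perfect_matching:
  "half_graph_perfect n \<in> matchings (half_graph n)"
proof -
  have "half_graph_perfect n \<subseteq> half_graph n"
    unfolding half_graph_perfect_def half_graph_def by auto
  moreover have "pairwise disjnt (half_graph_perfect n)"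
    unfolding half_graph_perfect_def
    by (intro pairwise_imageI) (auto simp: disjnt_def double_not_eq_Suc_double Suc_double_not_eq_double)
  ultimately show ?thesis
    unfolding matchings_def by simp
qed

lemma card_half_graph_perfect: "card (half_graph_perfect n) = n"
proof -
  have "inj_on (\<lambda>j. {2 * j, 2 * j + 1}) {..<n}"
    by (rule inj_onI) (auto simp: doubleton_eq_iff)
  then show ?thesis
    unfolding half_graph_perfect_def by (simp add: card_image)
qed

lemma half_graph_edge_meets_evens:
  assumes "e \<in> half_graph n"
  shows "e \<inter> (*) 2 ` {..<n} \<noteq> {}"
  using assms unfolding half_graph_def by auto

lemma card_evens: "card ((*) 2 ` {..<n :: nat}) = n"
  by (simp add: card_image inj_on_def)

lemma half_graph_matching_card_le:
  assumes "M \<in> matchings (half_graph n)"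
  shows "card M \<le> n"
proof -
  have "card M \<le> card ((*) 2 ` {..<n})"
    using assms half_graph_edge_meets_evens unfolding matchings_def
    by (intro matching_card_le_cover(1)) auto
  then show ?thesis
    by (simp only: card_evens)
qed

text \<open>With \<open>n\<close> edges every even vertex is matched, since the even side is a
  vertex cover of size \<open>n\<close>. By strong induction on \<open>j\<close>, the neighbours
  \<open>2 * i + 1\<close> of \<open>2 * j\<close> with \<open>i < j\<close> are already taken by
  \<open>2 * i\<close>, which leaves only \<open>2 * j + 1\<close>.\<close>

lemma half_graph_perfect_unique:
  assumes "M \<in> matchings (half_graph n)" "card M = n"
  shows "M = half_graph_perfect n"
proof -
  have ME: "M \<subseteq> half_graph n" and disj: "pairwise disjnt M"
    using assms(1) by (auto simp: matchings_def)
  have cover: "\<exists>e\<in>M. 2 * j \<in> e" if "j < n" for j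
    using ME disj half_graph_edge_meets_evens assms(2) that
    by (intro matching_card_le_cover(2)[where C = "(*) 2 ` {..<n}"])
       (auto simp: card_evens)
  have in_M: "j < n \<Longrightarrow> {2 * j, 2 * j + 1} \<in> M" for j
  proof (induction j rule: less_induct)
    case (less j)
    obtain e where e: "e \<in> M" "2 * j \<in> e"
      using cover less.prems by blast
    then obtain i j' where ij: "e = {2 * j', 2 * i + 1}" "i \<le> j'"
      using ME unfolding half_graph_def by blast
    have "j' = j"
      using e(2) ij(1) by auto presburger
    have "i = j"
    proof (rule ccontr)
      assume "i \<noteq> j"
      then have "i < j"
        using ij(2) \<open>j' = j\<close> by simp
      then have "{2 * i, 2 * i + 1} \<in> M"
        using less by simp
      moreover have "{2 * i, 2 * i + 1} \<noteq> e"
        using ij(1) \<open>j' = j\<close> \<open>i < j\<close> by (auto simp: doubleton_eq_iff)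
      ultimately have "disjnt {2 * i, 2 * i + 1} e"
        using disj e(1) by (meson pairwiseD)
      then show False
        using ij(1) by simp
    qed
    then show ?case
      using e(1) ij(1) \<open>j' = j\<close> by simp
  qed
  have "half_graph_perfect n \<subseteq> M"
    using in_M unfolding half_graph_perfect_def by auto
  then have "half_graph_perfect n = M"
    using finite_subset[OF ME finite_half_graph] assms(2)
    by (intro card_subset_eq) (auto simp: card_half_graph_perfect)
  then show ?thesis ..
qed

lemma half_graph_max_matching: "max_matching_size (half_graph n) = n"
  unfolding max_matching_size_def
proof (rule Max_eqI)
  show "finite (card ` matchings (half_graph n))"
    using finite_matchings[OF finite_half_graph] by simp
  show "n \<in> card ` matchings (half_graph n)"
    using half_graph_perfect_matching[of n] card_half_graph_perfect[of n] by force
qed (use half_graph_matching_card_le in auto)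

section \<open>Exponentially many near-perfect matchings\<close>

text \<open>The vertices \<open>4i + 1, \<dots>, 4i + 4\<close> span a 4-cycle for each \<open>i < k\<close>, and the set \<open>S\<close>
  selects one of the two perfect matchings of each cycle.\<close>

definition cycle_choice :: "nat set \<Rightarrow> nat \<Rightarrow> nat" where
  "cycle_choice S m =
    (if m div 2 \<in> S then if even m then m + 2 else m else m + 1)"

text \<open>In the half graph with \<open>n = 2 * k + 1\<close>, only the vertices \<open>0\<close>
  and \<open>4 * k + 1\<close> stay unmatched.\<close>

definition near_perfect :: "nat \<Rightarrow> nat set \<Rightarrow> nat set set" where
  "near_perfect k S = (\<lambda>m. {2 * cycle_choice S m, 2 * m + 1}) ` {..<2 * k}"

lemma cycle_choice_inject: "cycle_choice S m = cycle_choice S m' \<longleftrightarrow> m = m'"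
proof
  \<comment> \<open>The indices \<open>2 * i\<close> and \<open>2 * i + 1\<close> are sent to
    \<open>2 * i + 1\<close> and \<open>2 * i + 2\<close> in some order, so the value determines the
    cycle \<open>i\<close>. Values are positive, so the subtraction does not truncate.\<close>
  have div: "(cycle_choice S m - 1) div 2 = m div 2" for m
    unfolding cycle_choice_def by (auto elim!: evenE oddE)
  assume eq: "cycle_choice S m = cycle_choice S m'"
  then have "m div 2 = m' div 2"
    using div by metis
  moreover from this eq have "even m \<longleftrightarrow> even m'"
    unfolding cycle_choice_def by (auto split: if_splits)
  ultimately show "m = m'"
    by presburger
qed simp

lemma edge_eq_iff:
  "{2 * a, 2 * b + 1} = {2 * c, 2 * d + 1} \<longleftrightarrow> a = c \<and> b = (d :: nat)"
  by (auto simp: doubleton_eq_iff) presburger+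

lemma near_perfect_matching:
  "near_perfect k S \<in> matchings (half_graph (2 * k + 1))"
proof -
  have "near_perfect k S \<subseteq> half_graph (2 * k + 1)"
  proof
    fix e assume "e \<in> near_perfect k S"
    then obtain m where m: "m < 2 * k" "e = {2 * cycle_choice S m, 2 * m + 1}"
      unfolding near_perfect_def by auto
    \<comment> \<open>The last cycle can use the even index \<open>2 * k\<close>, hence the
      parameter \<open>2 * k + 1\<close>.\<close>
    have "m \<le> cycle_choice S m" "cycle_choice S m < 2 * k + 1"
      using m(1) unfolding cycle_choice_def by (auto elim!: evenE)
    then show "e \<in> half_graph (2 * k + 1)"
      using m(2) unfolding half_graph_def by blast
  qed
  moreover have "disjnt {2 * cycle_choice S m, 2 * m + 1} {2 * cycle_choice S m', 2 * m' + 1}"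
    if "m \<noteq> m'" for m m'
    using that cycle_choice_inject[of S m m'] by (auto simp: disjnt_def) presburger+
  then have "pairwise disjnt (near_perfect k S)"
    unfolding near_perfect_def by (intro pairwise_imageI) auto
  ultimately show ?thesis
    unfolding matchings_def by simp
qed

lemma card_near_perfect: "card (near_perfect k S) = 2 * k"
proof -
  have "inj_on (\<lambda>m. {2 * cycle_choice S m, 2 * m + 1}) {..<2 * k}"
    by (rule inj_onI) (simp only: edge_eq_iff)
  then show ?thesis
    unfolding near_perfect_def by (simp add: card_image)
qed

lemma near_perfect_inj: "inj_on (near_perfect k) (Pow {..<k})"
proof -
  \<comment> \<open>The edge from \<open>4i + 1\<close> to \<open>4i + 4\<close> belongs to just one
    of the two matchings of its cycle, so it reveals whether \<open>i\<close> lies in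
    \<open>S\<close>.\<close>
  have mem: "i \<in> S \<longleftrightarrow> {2 * (2 * i + 2), 2 * (2 * i) + 1} \<in> near_perfect k S" if "i < k" for i S
  proof -
    have "{2 * (2 * i + 2), 2 * (2 * i) + 1} \<in> near_perfect k S \<longleftrightarrow>
        2 * i + 2 = cycle_choice S (2 * i)"
      using that unfolding near_perfect_def image_iff edge_eq_iff by auto
    then show ?thesis
      by (simp add: cycle_choice_def)
  qed
  show ?thesis
  proof (rule inj_onI)
    fix S T assume "S \<in> Pow {..<k}" "T \<in> Pow {..<k}" "near_perfect k S = near_perfect k T"
    then show "S = T"
      using mem[of _ S] mem[of _ T] by blast
  qed
qed

section \<open>Expected size of a random matching\<close>

lemma expectation_matching_gibbs:
  assumes "finite E" "lam \<ge> 0"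
  shows "measure_pmf.expectation (matching_gibbs lam E) (\<lambda>M. real (card M)) *
      matching_partition_function lam E = (\<Sum>M\<in>matchings E. real (card M) * lam ^ card M)"
proof -
  let ?Z = "matching_partition_function lam E"
  have "measure_pmf.expectation (matching_gibbs lam E) (\<lambda>M. real (card M)) =
      (\<Sum>M\<in>matchings E. real (card M) * pmf (matching_gibbs lam E) M)"
    by (rule integral_measure_pmf_real[OF finite_matchings[OF assms(1)]])
       (auto simp: set_pmf_iff pmf_matching_gibbs[OF assms] split: if_splits)
  also have "\<dots> = (\<Sum>M\<in>matchings E. real (card M) * lam ^ card M) / ?Z"
    by (simp add: pmf_matching_gibbs[OF assms] sum_divide_distrib)
  finally show ?thesis
    using matching_partition_function_pos[OF assms] by simp
qed

lemma half_graph_expectation_less: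
  assumes "0 \<le> lam" "lam < 2 ^ k"
  shows "measure_pmf.expectation (matching_gibbs lam (half_graph (2 * k + 1)))
      (\<lambda>M. real (card M)) < real (2 * k + 1) - 1 / 2"
proof -
  define n where "n = 2 * k + 1"
  define P where "P = half_graph_perfect n"
  define Ms where "Ms = matchings (half_graph n)"
  define Z where "Z = matching_partition_function lam (half_graph n)"
  define A where "A = (\<Sum>M\<in>Ms - {P}. lam ^ card M)"
  define X where
    "X = measure_pmf.expectation (matching_gibbs lam (half_graph n)) (\<lambda>M. real (card M))"
  have fin: "finite Ms"
    unfolding Ms_def by (rule finite_matchings[OF finite_half_graph])
  have P: "P \<in> Ms" "card P = n"
    unfolding P_def Ms_def by (rule half_graph_perfect_matching card_half_graph_perfect)+
  have Z: "Z = lam ^ n + A"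
    unfolding Z_def matching_partition_function_def A_def
    using sum.remove[OF fin P(1), of "\<lambda>M. lam ^ card M"] P(2) by (simp add: Ms_def)
  have Zpos: "Z > 0"
    unfolding Z_def by (rule matching_partition_function_pos[OF finite_half_graph assms(1)])
  have "(\<Sum>M\<in>Ms - {P}. real (card M) * lam ^ card M)
      \<le> (\<Sum>M\<in>Ms - {P}. (real n - 1) * lam ^ card M)"
  proof (rule sum_mono)
    fix M assume "M \<in> Ms - {P}"
    then have "card M \<le> n" "card M \<noteq> n"
      using half_graph_matching_card_le half_graph_perfect_unique
      unfolding Ms_def P_def by blast+
    then have "real (card M) \<le> real n - 1"
      by linarith
    then show "real (card M) * lam ^ card M \<le> (real n - 1) * lam ^ card M"
      using assms(1) by (intro mult_right_mono) auto
  qed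
  also have "\<dots> = (real n - 1) * A"
    by (simp add: A_def sum_distrib_left)
  finally have "X * Z \<le> real n * lam ^ n + (real n - 1) * A"
    unfolding X_def Z_def expectation_matching_gibbs[OF finite_half_graph assms(1)]
    using sum.remove[OF fin P(1), of "\<lambda>M. real (card M) * lam ^ card M"] P(2)
    by (simp add: Ms_def)
  \<comment> \<open>Every matching other than \<open>P\<close> misses at least one edge, so the
    expected deficit is at least \<open>A / Z\<close>.\<close>
  then have XZ: "X * Z \<le> real n * Z - A"
    by (simp add: Z algebra_simps)
  \<comment> \<open>At \<open>lam = 0\<close> the near-perfect matchings may have weight zero, but
    the empty one has weight \<open>0 ^ 0 = 1\<close>. Otherwise the \<open>2 ^ k\<close>
    near-perfect matchings outweigh \<open>P\<close>, as
    \<open>lam ^ n = lam * lam ^ (2 * k)\<close>.\<close>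
  have "lam ^ n < A"
  proof (cases "lam = 0")
    case True
    have "{} \<in> Ms - {P}"
      using empty_in_matchings P(2) unfolding Ms_def n_def by auto
    then have "lam ^ card ({} :: nat set set) \<le> A"
      unfolding A_def using fin assms(1)
      by (intro member_le_sum[where f = "\<lambda>M. lam ^ card M"]) auto
    then show ?thesis
      by (simp add: True n_def)
  next
    case False
    have "lam ^ n < 2 ^ k * lam ^ (2 * k)"
      using False assms by (simp add: n_def)
    also have "\<dots> = (\<Sum>M\<in>near_perfect k ` Pow {..<k}. lam ^ card M)"
      by (simp add: sum.reindex[OF near_perfect_inj] card_near_perfect card_Pow)
    also have "\<dots> \<le> A"
      unfolding A_def
    proof (rule sum_mono2)
      have "near_perfect k S \<noteq> P" for S
        using P(2) card_near_perfect[of k S] by (auto simp: n_def)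
      then show "near_perfect k ` Pow {..<k} \<subseteq> Ms - {P}"
        using near_perfect_matching unfolding Ms_def n_def by auto
    qed (use fin assms(1) in auto)
    finally show ?thesis .
  qed
  then have "A > Z / 2"
    by (simp add: Z)
  with XZ have "X * Z < (real n - 1 / 2) * Z"
    by (simp add: algebra_simps)
  then show ?thesis
    using Zpos unfolding X_def n_def by simp
qed

section \<open>Choice of parameters\<close>

theorem theorem6p1:
  "\<exists>\<epsilon>\<^sub>0 > (0::real). \<exists>c > (0::real). \<forall>\<epsilon> lam :: real.
     0 < \<epsilon> \<longrightarrow> \<epsilon> < \<epsilon>\<^sub>0 \<longrightarrow> 0 \<le> lam \<longrightarrow>
     (\<forall>(V :: nat set) E. finite_simple_graph V E \<longrightarrow>
        measure_pmf.expectation (matching_gibbs lam E) (\<lambda>M. real (card M))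
          \<ge> (1 - \<epsilon>) * real (max_matching_size E)) \<longrightarrow>
     lam \<ge> 2 powr (c / \<epsilon>)"
proof (rule exI[of _ "1 / 12"], rule conjI, simp, rule exI[of _ "1 / 8"], rule conjI, simp,
    intro allI impI)
  fix \<epsilon> lam :: real
  assume eps: "0 < \<epsilon>" "\<epsilon> < 1 / 12" and lam: "0 \<le> lam"
    and large: "\<forall>(V :: nat set) E. finite_simple_graph V E \<longrightarrow>
        measure_pmf.expectation (matching_gibbs lam E) (\<lambda>M. real (card M))
          \<ge> (1 - \<epsilon>) * real (max_matching_size E)"
  \<comment> \<open>The largest \<open>k\<close> with
    \<open>\<epsilon> * (2 * k + 1) \<le> 1 / 2\<close>: the allowed deficit then does not exceed
    the \<open>1 / 2\<close> lost when \<open>lam < 2 ^ k\<close>.\<close>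
  define k where "k = nat \<lfloor>1 / (4 * \<epsilon>) - 1 / 2\<rfloor>"
  have inv: "1 / \<epsilon> > 12"
    using eps by (simp add: field_simps)
  have "1 / (4 * \<epsilon>) = 1 / \<epsilon> / 4"
    by simp
  with inv have k: "real k \<le> 1 / (4 * \<epsilon>) - 1 / 2" "1 / (4 * \<epsilon>) - 3 / 2 < real k"
    unfolding k_def by linarith+
  have "\<epsilon> * real (2 * k + 1) \<le> 1 / 2"
    using k(1) eps(1) by (simp add: field_simps)
  then have "real (2 * k + 1) - 1 / 2 \<le> (1 - \<epsilon>) * real (2 * k + 1)"
    by (simp add: algebra_simps)
  also have "\<dots> \<le> measure_pmf.expectation (matching_gibbs lam (half_graph (2 * k + 1)))
      (\<lambda>M. real (card M))"
    using large half_graph_simple[of "2 * k + 1"] half_graph_max_matching[of "2 * k + 1"]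
    by metis
  finally have "2 ^ k \<le> lam"
    using half_graph_expectation_less[OF lam, of k] by linarith
  \<comment> \<open>Both constants come from here: rounding leaves
    \<open>k > 1 / (4 * \<epsilon>) - 3 / 2\<close>, and half of the main term absorbs
    \<open>3 / 2\<close> once \<open>1 / \<epsilon> \<ge> 12\<close>.\<close>
  moreover have "1 / 8 / \<epsilon> \<le> real k"
    using k(2) inv by (simp add: field_simps)
  then have "2 powr (1 / 8 / \<epsilon>) \<le> 2 powr real k"
    by (intro powr_mono) auto
  ultimately show "lam \<ge> 2 powr (1 / 8 / \<epsilon>)"
    by (simp add: powr_realpow)
qed

end
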